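(* Let $I$ be a finite set and $T$ a tree on $I$. The elements of the intersection lattice $L_T$ of the arrangement $H_T$ are in bijection with the forests $F$ on $I$ which satisfy $F\subseteq T$.
   Context: A tree on a finite set $I$ is a labeled rooted tree with vertex set $I$; equivalently, a partial order $\leq_T$ on $I$ with a unique minimal element (the root) such that the interval between the root and any element is a chain. $H_T$ is the central hyperplane arrangement in $\mathbb{C}^I$ (coordinates $x_i$) consisting of the hyperplanes $x_i=x_j$ for $i<_T j$. $L_T$ is the lattice of all intersections of hyperplanes of $H_T$ (including $\mathbb{C}^I$, the empty intersection), ordered by reverse inclusion. A forest on $I$ is an acyclic graph with vertex set $I$ in which each connected component has a distinguished vertex called its root; so it is a partition $\pi(F)$ of $I$ together with a rooted tree on each part. A forest is seen as a poset: $i\leq_F j$ if $i,j$ are in the same tree of $F$ and $i$ is on the path from $j$ to the root of this tree. For forests $F',F$ on $I$, $F'\subseteq F$ means: $\pi(F')$ is finer than (or equal to) $\pi(F)$, and each tree of $F'$ is induced by $F$ as a poset (on each part of $\pi(F')$ the order $\leq_{F'}$ is the restriction of $\leq_F$). *)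

theory Defs
  imports Complex_Main "HOL-Library.FuncSet" "HOL-Library.Disjoint_Sets"
begin

section \<open>Rooted trees and forests as orders\<close>

definition minimal_in :: "'a set \<Rightarrow> 'a rel \<Rightarrow> 'a \<Rightarrow> bool" where
  "minimal_in I r m \<longleftrightarrow> m \<in> I \<and> (\<forall>y\<in>I. (y, m) \<in> r \<longrightarrow> y = m)"

text \<open>A rooted tree is represented by its reflexive order relation, with the root at the
  bottom: \<open>(i, j) \<in> T\<close> means that \<open>i\<close> lies on the path from \<open>j\<close> to the root.\<close>

definition tree_on :: "'a set \<Rightarrow> 'a rel \<Rightarrow> bool" where
  "tree_on I T \<longleftrightarrow> partial_order_on I T \<and>
     (\<exists>!m. minimal_in I T m) \<and>
     (\<forall>m x. minimal_in I T m \<and> x \<in> I \<longrightarrow> {y. (m, y) \<in> T \<and> (y, x) \<in> T} \<in> Chains T)"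

text \<open>A forest \<open>(\<pi>, r)\<close> consists of a partition \<open>\<pi>\<close> and the union \<open>r\<close> of the tree
  orders on the parts; the tree on the part \<open>B\<close> is recovered as \<open>Restr r B\<close>.\<close>

type_synonym 'a forest = "'a set set \<times> 'a rel"

definition forest_on :: "'a set \<Rightarrow> 'a forest \<Rightarrow> bool" where
  "forest_on I F \<longleftrightarrow> partition_on I (fst F) \<and>
     snd F \<subseteq> (\<Union>B\<in>fst F. B \<times> B) \<and> (\<forall>B\<in>fst F. tree_on B (Restr (snd F) B))"

definition forest_of_tree :: "'a set \<Rightarrow> 'a rel \<Rightarrow> 'a forest" where
  "forest_of_tree I T = ({I}, T)"

lemma forest_on_forest_of_tree:
  assumes "tree_on I T"
  shows "forest_on I (forest_of_tree I T)"
proof -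
  have "T \<subseteq> I \<times> I" "I \<noteq> {}"
    using assms by (auto simp: tree_on_def partial_order_on_def preorder_on_def minimal_in_def)
  moreover from this have "Restr T I = T" by blast
  ultimately show ?thesis
    using assms by (simp add: forest_on_def forest_of_tree_def partition_on_def)
qed

definition forest_subset :: "'a set \<Rightarrow> 'a forest \<Rightarrow> 'a forest \<Rightarrow> bool" where
  "forest_subset I F' F \<longleftrightarrow> refines I (fst F') (fst F) \<and>
     (\<forall>B\<in>fst F'. Restr (snd F') B = Restr (snd F) B)"

section \<open>The hyperplane arrangement of a tree\<close>

text \<open>\<open>\<complex>\<^sup>I\<close> is the set of extensional functions, so that vectors are determined
  by their coordinates in \<open>I\<close>.\<close>

definition coord_space :: "'a set \<Rightarrow> ('a \<Rightarrow> complex) set" where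
  "coord_space I = I \<rightarrow>\<^sub>E UNIV"

definition hyperplane :: "'a set \<Rightarrow> 'a \<Rightarrow> 'a \<Rightarrow> ('a \<Rightarrow> complex) set" where
  "hyperplane I i j = {x \<in> coord_space I. x i = x j}"

definition arrangement :: "'a set \<Rightarrow> 'a rel \<Rightarrow> ('a \<Rightarrow> complex) set set" where
  "arrangement I T = {hyperplane I i j | i j. (i, j) \<in> T \<and> i \<noteq> j}"

definition intersection_lattice :: "'a set \<Rightarrow> 'a rel \<Rightarrow> ('a \<Rightarrow> complex) set set" where
  "intersection_lattice I T = {coord_space I \<inter> \<Inter>S | S. S \<subseteq> arrangement I T}"

end

theory Submission
  imports Defs
begin

text \<open>The intersection of a set of hyperplanes \<open>x\<^sub>i = x\<^sub>j\<close> consists of the vectors that are constant on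
  the connected components of the graph with edges \<open>{i, j}\<close>. All these edges join comparable
  elements of \<open>T\<close>, and two elements below a common one are comparable, so by induction on the length
  of a path any two elements of a component have a lower bound in it; hence \<open>T\<close> induces a tree
  on the component. Conversely, the vectors that are constant on a part \<open>B\<close> of a forest \<open>F \<subseteq> T\<close> are cut
  out by the hyperplanes \<open>x\<^sub>m = x\<^sub>j\<close> with \<open>m\<close> the root and \<open>j\<close> another vertex of \<open>B\<close>. The
  parts are recovered from the flat with the help of their indicator vectors.\<close>

text \<open>A minimal element of the finite nonempty set of elements below \<open>x\<close> is
  minimal in all of \<open>I\<close>, since by transitivity anything beneath it is again below
  \<open>x\<close>.\<close>

lemma ex_minimal_in_below:
  assumes "finite I" "partial_order_on I r" "x \<in> I"
  shows "\<exists>m. minimal_in I r m \<and> (m, x) \<in> r"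
proof -
  let ?D = "{y \<in> I. (y, x) \<in> r}" and ?R = "\<lambda>a b. (a, b) \<in> r \<and> a \<noteq> b"
  have r: "r \<subseteq> I \<times> I" "refl_on I r" "trans r" "antisym r"
    using assms(2) by (auto simp: partial_order_on_def preorder_on_def)
  have "transp_on ?D ?R" "asymp_on ?D ?R"
    using r(3,4) by (auto intro!: transp_onI asymp_onI dest: transD antisymD)
  moreover have "finite ?D" "?D \<noteq> {}"
    using assms(1,3) r(2) by (auto dest: refl_onD)
  ultimately obtain m where "m \<in> ?D" "\<forall>y\<in>?D. y \<noteq> m \<longrightarrow> \<not> ?R y m"
    using Finite_Set.bex_min_element[of ?D ?R] by blast
  then have "minimal_in I r m \<and> (m, x) \<in> r"
    using r(3) unfolding minimal_in_def by (blast dest: transD)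
  then show ?thesis ..
qed

lemma tree_on_order:
  assumes "tree_on I T"
  shows "T \<subseteq> I \<times> I" "refl_on I T" "trans T" "antisym T"
  using assms by (simp_all add: tree_on_def partial_order_on_def preorder_on_def)

lemma tree_on_least:
  assumes "finite I" "tree_on I T"
  obtains m where "minimal_in I T m" "\<forall>x\<in>I. (m, x) \<in> T"
  using assms ex_minimal_in_below[OF assms(1)] unfolding tree_on_def by metis

text \<open>The root lies below everything, so \<open>a\<close> and \<open>b\<close> both lie in the
  interval from the root to \<open>c\<close>, which is a chain.\<close>

lemma tree_on_below_comparable:
  assumes "finite I" "tree_on I T" "(a, c) \<in> T" "(b, c) \<in> T"
  shows "(a, b) \<in> T \<or> (b, a) \<in> T"
proof -
  have T: "T \<subseteq> I \<times> I"
    using tree_on_order(1)[OF assms(2)] .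
  obtain m where m: "minimal_in I T m" "\<forall>x\<in>I. (m, x) \<in> T"
    using tree_on_least[OF assms(1,2)] .
  have "c \<in> I" "(m, a) \<in> T" "(m, b) \<in> T"
    using T assms(3,4) m(2) by auto
  moreover from this have "{y. (m, y) \<in> T \<and> (y, c) \<in> T} \<in> Chains T"
    using assms(2) m(1) by (simp add: tree_on_def)
  ultimately show ?thesis
    using assms(3,4) by (auto simp: Chains_def)
qed

text \<open>Two minimal elements of \<open>B\<close> have a lower bound in \<open>B\<close>, which
  must equal both; so there is only one root. Intervals stay chains because elements of
  \<open>T\<close> below a common one are comparable.\<close>

lemma tree_on_Restr:
  assumes "finite I" "tree_on I T" "B \<subseteq> I" "B \<noteq> {}"
    and lower: "\<And>x y. x \<in> B \<Longrightarrow> y \<in> B \<Longrightarrow> \<exists>l\<in>B. (l, x) \<in> T \<and> (l, y) \<in> T"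
  shows "tree_on B (Restr T B)"
proof -
  have "refl_on B (Restr T B)"
    using tree_on_order(2)[OF assms(2)] assms(3) by (auto simp: refl_on_def)
  then have po: "partial_order_on B (Restr T B)"
    using tree_on_order(3,4)[OF assms(2)]
    by (simp add: partial_order_on_def preorder_on_def trans_Restr antisym_Restr)
  have "\<exists>m. minimal_in B (Restr T B) m"
    using ex_minimal_in_below[OF _ po] assms(1,3,4) by (meson ex_in_conv finite_subset)
  moreover have "a = b" if "minimal_in B (Restr T B) a" "minimal_in B (Restr T B) b" for a b
    using that lower[of a b] unfolding minimal_in_def by blast
  moreover have "{y. (m, y) \<in> Restr T B \<and> (y, x) \<in> Restr T B} \<in> Chains (Restr T B)" for m x
    using tree_on_below_comparable[OF assms(1,2)] unfolding Chains_def by blast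
  ultimately show ?thesis
    using po unfolding tree_on_def by (metis (no_types, lifting))
qed

lemma connected_lower_bound:
  assumes "finite I" "tree_on I T" "E \<subseteq> T" "x \<in> I" "(x, y) \<in> (E \<union> E\<inverse>)\<^sup>*"
  shows "\<exists>l. (x, l) \<in> (E \<union> E\<inverse>)\<^sup>* \<and> (l, x) \<in> T \<and> (l, y) \<in> T"
  using assms(5)
proof (induction rule: rtrancl_induct)
  case base
  then show ?case
    using refl_onD[OF tree_on_order(2)[OF assms(2)] assms(4)] by blast
next
  case (step y z)
  then obtain l where l: "(x, l) \<in> (E \<union> E\<inverse>)\<^sup>*" "(l, x) \<in> T" "(l, y) \<in> T"
    by blast
  note tr = transD[OF tree_on_order(3)[OF assms(2)]]
  have xz: "(x, z) \<in> (E \<union> E\<inverse>)\<^sup>*"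
    using step.hyps by (rule rtrancl_into_rtrancl)
  from step.hyps(2) consider "(y, z) \<in> T" | "(z, y) \<in> T"
    using assms(3) by auto
  then show ?case
  proof cases
    case 1
    then show ?thesis
      using l tr by blast
  next
    case 2
    \<comment> \<open>Both \<open>l\<close> and \<open>z\<close> lie below \<open>y\<close>, so they
      are comparable. If \<open>l\<close> is the smaller one it remains a lower bound; otherwise
      \<open>z\<close> takes its place, being reachable from \<open>x\<close> by \<open>xz\<close>
      and below itself.\<close>
    have "(z, z) \<in> T"
      using 2 tree_on_order(1,2)[OF assms(2)] by (auto dest: refl_onD)
    then show ?thesis
      using tree_on_below_comparable[OF assms(1,2) l(3) 2] l xz tr by blast
  qed
qed

definition flat :: "'a set \<Rightarrow> 'a set set \<Rightarrow> ('a \<Rightarrow> complex) set" where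
  "flat I \<pi> = {x \<in> coord_space I. \<forall>B\<in>\<pi>. \<forall>i\<in>B. \<forall>j\<in>B. x i = x j}"

lemma partition_from_flat:
  assumes "partition_on I \<pi>"
  shows "\<pi> = (\<lambda>i. {j \<in> I. \<forall>x\<in>flat I \<pi>. x i = x j}) ` I"
proof -
  have part: "\<Union>\<pi> = I" "{} \<notin> \<pi>" "disjoint \<pi>"
    using assms by (simp_all add: partition_on_def)
  then have disj: "B = C" if "B \<in> \<pi>" "C \<in> \<pi>" "i \<in> B" "i \<in> C" for B C i
    using that by (auto dest: disjointD)
  have eq: "{j \<in> I. \<forall>x\<in>flat I \<pi>. x i = x j} = B" if "B \<in> \<pi>" "i \<in> B" for B i
  proof -
    \<comment> \<open>The indicator vector of \<open>B\<close>; the value \<open>undefined\<close>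
      outside \<open>I\<close> makes it extensional. It is constant on the other parts because they
      are disjoint from \<open>B\<close>, and it separates \<open>i\<close> from every coordinate
      outside \<open>B\<close>.\<close>
    define e :: "'a \<Rightarrow> complex"
      where "e = (\<lambda>k. if k \<in> I then if k \<in> B then 1 else 0 else undefined)"
    have "e \<in> flat I \<pi>"
      using part(1) disj[OF that(1)] unfolding flat_def coord_space_def e_def by auto
    moreover have "e i \<noteq> e j" if "j \<in> I" "j \<notin> B" for j
      using that \<open>B \<in> \<pi>\<close> \<open>i \<in> B\<close> part(1) by (auto simp: e_def)
    ultimately have "j \<in> B" if "j \<in> I" "\<forall>x\<in>flat I \<pi>. x i = x j" for j
      using that by blast
    moreover have "j \<in> I \<and> (\<forall>x\<in>flat I \<pi>. x i = x j)" if "j \<in> B" for j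
      using that \<open>B \<in> \<pi>\<close> \<open>i \<in> B\<close> part(1) unfolding flat_def by blast
    ultimately show ?thesis by blast
  qed
  show ?thesis
  proof (intro equalityI subsetI)
    fix B assume B: "B \<in> \<pi>"
    then obtain i where "i \<in> B" using part(2) by fastforce
    then show "B \<in> (\<lambda>i. {j \<in> I. \<forall>x\<in>flat I \<pi>. x i = x j}) ` I"
      using eq[OF B] B part(1) by blast
  next
    fix B assume "B \<in> (\<lambda>i. {j \<in> I. \<forall>x\<in>flat I \<pi>. x i = x j}) ` I"
    then show "B \<in> \<pi>" using eq part(1) by auto
  qed
qed

lemma flat_inject:
  assumes "partition_on I \<pi>" "partition_on I \<pi>'" "flat I \<pi> = flat I \<pi>'"
  shows "\<pi> = \<pi>'"
  using partition_from_flat[OF assms(1)] partition_from_flat[OF assms(2)] assms(3) by simp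

lemma flat_in_intersection_lattice:
  assumes "\<And>B. B \<in> \<pi> \<Longrightarrow> finite B" "\<And>B. B \<in> \<pi> \<Longrightarrow> tree_on B (Restr T B)"
  shows "flat I \<pi> \<in> intersection_lattice I T"
proof -
  \<comment> \<open>Taking all comparable pairs inside a part avoids choosing roots here. The pairs
    that contain the root of a part already force a vector to be constant on it.\<close>
  define S where "S = {hyperplane I i j | i j. (i, j) \<in> T \<and> i \<noteq> j \<and> (\<exists>B\<in>\<pi>. i \<in> B \<and> j \<in> B)}"
  have const: "x i = x j" if x: "x \<in> coord_space I \<inter> \<Inter>S" and B: "B \<in> \<pi>" "i \<in> B" "j \<in> B" for x B i j
  proof -
    obtain m where m: "minimal_in B (Restr T B) m" "\<forall>k\<in>B. (m, k) \<in> Restr T B"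
      using tree_on_least[OF assms(1)[OF B(1)] assms(2)[OF B(1)]] .
    have "x m = x k" if "k \<in> B" for k
    proof (cases "k = m")
      case False
      then have "hyperplane I m k \<in> S"
        using m B(1) that unfolding S_def by blast
      then show ?thesis using x unfolding hyperplane_def by blast
    qed simp
    then show ?thesis using B by metis
  qed
  have "flat I \<pi> = coord_space I \<inter> \<Inter>S"
  proof (intro equalityI subsetI)
    fix x assume "x \<in> flat I \<pi>"
    then show "x \<in> coord_space I \<inter> \<Inter>S"
      unfolding S_def flat_def hyperplane_def by blast
  next
    fix x assume "x \<in> coord_space I \<inter> \<Inter>S"
    then show "x \<in> flat I \<pi>"
      using const unfolding flat_def by auto
  qed
  moreover have "S \<subseteq> arrangement I T"
    unfolding S_def arrangement_def by blast
  ultimately show ?thesis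
    unfolding intersection_lattice_def by blast
qed

lemma intersection_lattice_is_flat:
  assumes "finite I" "tree_on I T" "X \<in> intersection_lattice I T"
  obtains \<pi> where "partition_on I \<pi>" "\<And>B. B \<in> \<pi> \<Longrightarrow> tree_on B (Restr T B)" "X = flat I \<pi>"
proof -
  obtain S where S: "S \<subseteq> arrangement I T" "X = coord_space I \<inter> \<Inter>S"
    using assms(3) unfolding intersection_lattice_def by blast
  \<comment> \<open>A hyperplane does not remember the order of \<open>i\<close> and
    \<open>j\<close>; the condition of lying in \<open>T\<close> orients each edge upwards, as
    \<open>connected_lower_bound\<close> requires.\<close>
  define E where "E = {(i, j) \<in> T. hyperplane I i j \<in> S}"
  \<comment> \<open>The closure is reflexive on the whole type, so it is cut down to
    \<open>I\<close>. The classes of \<open>R\<close> are the connected components.\<close>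
  define R where "R = (E \<union> E\<inverse>)\<^sup>* \<inter> I \<times> I"
  have E: "E \<subseteq> T" "E \<subseteq> I \<times> I"
    using tree_on_order(1)[OF assms(2)] by (auto simp: E_def)
  have closed: "j \<in> I" if "(i, j) \<in> (E \<union> E\<inverse>)\<^sup>*" "i \<in> I" for i j
    using that by (induction rule: rtrancl_induct) (use E(2) in auto)
  have "sym (E \<union> E\<inverse>)"
    by (auto simp: sym_def)
  then have "sym ((E \<union> E\<inverse>)\<^sup>*)"
    by (rule sym_rtrancl)
  then have equiv: "equiv I R"
    unfolding R_def equiv_def refl_on_def sym_def trans_def by (auto intro: rtrancl_trans)
  have trees: "tree_on B (Restr T B)" if "B \<in> I // R" for B
  proof (rule tree_on_Restr[OF assms(1,2)])
    show "B \<subseteq> I" "B \<noteq> {}"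
      using in_quotient_imp_subset[OF equiv that] in_quotient_imp_non_empty[OF equiv that] .
    fix x y assume xy: "x \<in> B" "y \<in> B"
    then have "(x, y) \<in> R"
      using quotient_eq_iff[OF equiv that that] by simp
    then obtain l where l: "(x, l) \<in> (E \<union> E\<inverse>)\<^sup>*" "(l, x) \<in> T" "(l, y) \<in> T"
      using connected_lower_bound[OF assms(1,2) E(1), of x y] unfolding R_def by blast
    have "(x, l) \<in> R"
      using l(1) closed[OF l(1)] \<open>(x, y) \<in> R\<close> unfolding R_def by blast
    then have "l \<in> B"
      using in_quotient_imp_closed[OF equiv that xy(1)] by blast
    then show "\<exists>l\<in>B. (l, x) \<in> T \<and> (l, y) \<in> T"
      using l by blast
  qed
  have flat_eq: "x \<in> flat I (I // R) \<longleftrightarrow> x \<in> coord_space I \<and> (\<forall>(i, j)\<in>R. x i = x j)" for x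
  proof -
    have "\<exists>B\<in>I // R. i \<in> B \<and> j \<in> B" if "(i, j) \<in> R" for i j
    proof -
      have "i \<in> I"
        using that by (simp add: R_def)
      then show ?thesis
        using that equiv_class_self[OF equiv] by (intro bexI[of _ "R `` {i}"] quotientI) auto
    qed
    moreover have "(i, j) \<in> R" if "B \<in> I // R" "i \<in> B" "j \<in> B" for B i j
      using quotient_eq_iff[OF equiv that(1,1,2,3)] by simp
    ultimately have "(i, j) \<in> R \<longleftrightarrow> (\<exists>B\<in>I // R. i \<in> B \<and> j \<in> B)" for i j
      by blast
    then show ?thesis
      unfolding flat_def by blast
  qed
  have "X = flat I (I // R)"
  proof (intro equalityI subsetI)
    fix x assume x: "x \<in> X"
    \<comment> \<open>Equality of coordinates passes from edges to whole paths; the converse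
      inclusion uses single edges only.\<close>
    have "x i = x j" if "(i, j) \<in> (E \<union> E\<inverse>)\<^sup>*" for i j
      using that
      by (induction rule: rtrancl_induct) (use x in \<open>auto simp: S(2) E_def hyperplane_def\<close>)
    then show "x \<in> flat I (I // R)"
      using x unfolding flat_eq S(2) by (auto simp: R_def)
  next
    fix x assume x: "x \<in> flat I (I // R)"
    have "x \<in> h" if h: "h \<in> S" for h
    proof -
      obtain i j where ij: "h = hyperplane I i j" "(i, j) \<in> T"
        using h S(1) unfolding arrangement_def by blast
      then have "(i, j) \<in> E"
        using h by (simp add: E_def)
      then have "(i, j) \<in> R"
        using E(2) unfolding R_def by blast
      then show ?thesis
        using x unfolding flat_eq ij(1) hyperplane_def by blast
    qed
    then show "x \<in> X"
      using x unfolding flat_eq S(2) by blast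
  qed
  from that[OF partition_on_quotient[OF equiv] trees this] show ?thesis .
qed

text \<open>A forest contained in \<open>T\<close> is determined by its partition, since its order
  on each part is that of \<open>T\<close>. This reduces the bijection to one between flats and the
  partitions of \<open>I\<close> whose parts induce trees.\<close>

lemma forest_in_tree_iff:
  assumes "I \<noteq> {}"
  shows "forest_on I F \<and> forest_subset I F (forest_of_tree I T) \<longleftrightarrow>
    partition_on I (fst F) \<and> snd F = (\<Union>B\<in>fst F. Restr T B) \<and>
    (\<forall>B\<in>fst F. tree_on B (Restr T B))" (is "?L \<longleftrightarrow> ?R")
proof
  assume L: ?L
  then have restr: "Restr (snd F) B = Restr T B" if "B \<in> fst F" for B
    using that unfolding forest_subset_def forest_of_tree_def by auto
  have "snd F = (\<Union>B\<in>fst F. Restr (snd F) B)"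
    using L unfolding forest_on_def by blast
  then show ?R
    using L restr unfolding forest_on_def by simp
next
  assume R: ?R
  then have part: "partition_on I (fst F)" and snd: "snd F = (\<Union>B\<in>fst F. Restr T B)"
    and trees: "\<forall>B\<in>fst F. tree_on B (Restr T B)" by auto
  have restr: "Restr (snd F) B = Restr T B" if "B \<in> fst F" for B
  proof -
    \<comment> \<open>Distinct parts are disjoint, so restricting the union to \<open>B\<close>
      leaves only the piece that comes from \<open>B\<close>.\<close>
    have "C = B" if "C \<in> fst F" "i \<in> B" "i \<in> C" for C i
      using part that \<open>B \<in> fst F\<close> unfolding partition_on_def disjoint_def by blast
    then show ?thesis
      using that unfolding snd by blast
  qed
  have "partition_on I {I}"
    using assms by (simp add: partition_on_def)
  then have "refines I (fst F) {I}"
    using part by (auto simp: refines_def partition_on_def)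
  then show ?L
    using part trees restr snd
    by (auto simp: forest_on_def forest_subset_def forest_of_tree_def)
qed

theorem proposition8:
  fixes I :: "'a set" and T :: "'a rel"
  assumes "finite I" and "tree_on I T"
  shows "\<exists>f. bij_betw f (intersection_lattice I T)
               {F. forest_on I F \<and> forest_subset I F (forest_of_tree I T)}"
proof -
  let ?\<F> = "{F. forest_on I F \<and> forest_subset I F (forest_of_tree I T)}"
  have "I \<noteq> {}"
    using assms(2) unfolding tree_on_def minimal_in_def by blast
  note forest_iff = forest_in_tree_iff[OF this, of _ T]
  \<comment> \<open>This direction needs no choice, as a forest determines its flat; the required
    \<open>f\<close> is the inverse.\<close>
  have "bij_betw (\<lambda>F. flat I (fst F)) ?\<F> (intersection_lattice I T)"
    unfolding bij_betw_def
  proof (intro conjI inj_onI equalityI subsetI)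
    fix F G assume "F \<in> ?\<F>" "G \<in> ?\<F>" "flat I (fst F) = flat I (fst G)"
    then show "F = G"
      using flat_inject[of I "fst F" "fst G"] unfolding mem_Collect_eq forest_iff
      by (simp add: prod_eq_iff)
  next
    fix X assume "X \<in> (\<lambda>F. flat I (fst F)) ` ?\<F>"
    then obtain F where F: "F \<in> ?\<F>" "X = flat I (fst F)" by blast
    have "finite B" if "B \<in> fst F" for B
      using F(1) that assms(1) unfolding mem_Collect_eq forest_iff partition_on_def
      by (meson Union_upper finite_subset order_eq_refl order_trans)
    then show "X \<in> intersection_lattice I T"
      using F flat_in_intersection_lattice[of "fst F" T I] unfolding mem_Collect_eq forest_iff by blast
  next
    fix X assume "X \<in> intersection_lattice I T"
    then obtain \<pi> where \<pi>: "partition_on I \<pi>" "\<And>B. B \<in> \<pi> \<Longrightarrow> tree_on B (Restr T B)" "X = flat I \<pi>"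
      using intersection_lattice_is_flat[OF assms] by blast
    then have "(\<pi>, \<Union>B\<in>\<pi>. Restr T B) \<in> ?\<F>"
      unfolding mem_Collect_eq forest_iff by simp
    then show "X \<in> (\<lambda>F. flat I (fst F)) ` ?\<F>"
      using \<pi>(3) by force
  qed
  then show ?thesis
    using bij_betw_inv_into by blast
qed

end
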